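(* Let $c$ and $d$ be two complex numbers. Then $$\left|\frac{c+d}{2}\right|\le \int_{0}^{1}\left|sc+(1-s)d\right|\,ds\le \frac{|c|+|d|}{2}.$$ *)

theory Defs
  imports "HOL-Analysis.Analysis"
begin

end

theory Submission
  imports Defs
begin

text \<open>
  The segment from \<open>b\<close> to \<open>a\<close> has mean value \<open>(a + b) / 2\<close>, in any Banach space. Both bounds
  come from this one fact. Used in the complex plane, it identifies the left-hand
  side as the modulus of the integral of the segment, which is at most the integral of the
  modulus. Used on the real line with end points \<open>cmod c\<close> and \<open>cmod d\<close>, it evaluates the
  integral of the chord that bounds the modulus from above by convexity of the norm.
\<close>

lemma has_integral_segment:
  fixes a b :: "'a::banach"
  shows "((\<lambda>s::real. s *\<^sub>R a + (1 - s) *\<^sub>R b) has_integral (1/2) *\<^sub>R (a + b)) {0..1}"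
proof -
  let ?F = "\<lambda>s::real. (s\<^sup>2 / 2) *\<^sub>R a + (s - s\<^sup>2 / 2) *\<^sub>R b"
  have "((\<lambda>s. s *\<^sub>R a + (1 - s) *\<^sub>R b) has_integral ?F 1 - ?F 0) {0..1}"
    by (rule fundamental_theorem_of_calculus) (auto intro!: derivative_eq_intros)
  then show ?thesis
    by (simp add: scaleR_add_right)
qed

theorem theorem2p1:
  fixes c d :: complex
  shows "cmod ((c + d) / 2) \<le> integral {0..1::real} (\<lambda>s. cmod (of_real s * c + (1 - of_real s) * d))
       \<and> integral {0..1::real} (\<lambda>s. cmod (of_real s * c + (1 - of_real s) * d)) \<le> (cmod c + cmod d) / 2"
proof -
  let ?p = "\<lambda>s::real. of_real s * c + (1 - of_real s) * d"
  let ?chord = "\<lambda>s::real. s * cmod c + (1 - s) * cmod d"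
  have p: "(?p has_integral (c + d) / 2) {0..1}"
    using has_integral_segment[of c d] by (simp add: scaleR_conv_of_real)
  have chord: "(?chord has_integral (cmod c + cmod d) / 2) {0..1}"
    using has_integral_segment[of "cmod c" "cmod d"] by simp
  have norm_p: "(\<lambda>s. cmod (?p s)) integrable_on {0..1}"
    by (intro integrable_continuous_real continuous_intros)
  have "cmod (integral {0..1} ?p) \<le> integral {0..1} (\<lambda>s. cmod (?p s))"
    using p norm_p by (intro integral_norm_bound_integral) auto
  moreover have "integral {0..1} (\<lambda>s. cmod (?p s)) \<le> integral {0..1} ?chord"
  proof (rule integral_le)
    fix s :: real
    assume s: "s \<in> {0..1}"
    have "cmod (?p s) \<le> cmod (of_real s * c) + cmod (of_real (1 - s) * d)"
      using norm_triangle_ineq[of "of_real s * c" "of_real (1 - s) * d"] by simp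
    also have "\<dots> = ?chord s"
      using s by (simp only: norm_mult norm_of_real) simp
    finally show "cmod (?p s) \<le> ?chord s" .
  qed (use norm_p chord in auto)
  ultimately show ?thesis
    using integral_unique[OF p] integral_unique[OF chord] by simp
qed

end
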